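(* Let $X_1,X_2\in\mathcal{X}(1)$. Then for every real $\alpha\ge 2$, $$d_{\mathrm{tv}}(X_1,X_2)\le d_\alpha(X_1,X_2).$$
   Context: For $x\in\mathbb{R}$ let $(x)_0=1$ and $(x)_k=x(x-1)\cdots(x-k+1)$ for $k=1,2,\ldots$; $\mathbb{E}(X)_k$ denotes the expectation of $(X)_k$ (the $k$-th descending factorial moment of $X$). For $t\in[0,\infty)$, $\mathcal{X}(t)$ is the set of random variables $X$ with values in $\{0,1,2,\ldots\}$ (almost surely) for which there exists $t'>t$ with $\mathbb{E}\big[(1+t')^{X}\big]<\infty$. Every $X\in\mathcal{X}(0)$ has finite factorial moments of all orders, and $\mathcal{X}(1)\subset\mathcal{X}(0)$. For $\alpha>0$ and $X_1,X_2\in\mathcal{X}(0)$, the factorial moment distance of order $\alpha$ is $$d_\alpha(X_1,X_2):=\sum_{k=1}^{\infty}\frac{\alpha^{k-1}}{k!}\big|\mathbb{E}(X_1)_k-\mathbb{E}(X_2)_k\big|\in[0,\infty].$$ The total variation distance is $d_{\mathrm{tv}}(X_1,X_2)=\sup_{A\in\mathcal{B}(\mathbb{R})}|\mathbb{P}(X_1\in A)-\mathbb{P}(X_2\in A)|$, where $\mathcal{B}(\mathbb{R})$ is the Borel $\sigma$-algebra of $\mathbb{R}$. *)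

theory Defs
  imports "HOL-Probability.Probability"
begin

definition descending_factorial :: "real \<Rightarrow> nat \<Rightarrow> real" where
  "descending_factorial x k = (\<Prod>i<k. x - real i)"

definition factorial_moment :: "'a measure \<Rightarrow> ('a \<Rightarrow> real) \<Rightarrow> nat \<Rightarrow> real" where
  "factorial_moment M X k = (\<integral>\<omega>. descending_factorial (X \<omega>) k \<partial>M)"

(* The class written X(t), for t >= 0, of random variables on M. The expectation of the
   positive variable (1 + t')^X is taken in [0, \<infinity>], so that its finiteness is a real
   condition; powr is the ordinary power because 1 + t' > 0. *)
definition rv_class :: "'a measure \<Rightarrow> real \<Rightarrow> ('a \<Rightarrow> real) set" where
  "rv_class M t = {X \<in> borel_measurable M. (AE \<omega> in M. X \<omega> \<in> \<nat>) \<and>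
     (\<exists>t'>t. (\<integral>\<^sup>+\<omega>. ennreal ((1 + t') powr X \<omega>) \<partial>M) < \<infinity>)}"

(* The two variables may live on different probability spaces: both distances depend only
   on their distributions. The index k below is the usual one (starting at 1) minus 1, and
   the series is summed in [0, \<infinity>]. The definition is intended for variables
   in rv_class M 0, whose factorial moments are all finite (a non-integrable function would
   have Bochner integral 0). *)
definition factorial_moment_dist ::
    "real \<Rightarrow> 'a measure \<Rightarrow> ('a \<Rightarrow> real) \<Rightarrow> 'b measure \<Rightarrow> ('b \<Rightarrow> real) \<Rightarrow> ennreal" where
  "factorial_moment_dist \<alpha> M\<^sub>1 X\<^sub>1 M\<^sub>2 X\<^sub>2 =
     (\<Sum>k. ennreal (\<alpha> ^ k / fact (Suc k) *
        \<bar>factorial_moment M\<^sub>1 X\<^sub>1 (Suc k) - factorial_moment M\<^sub>2 X\<^sub>2 (Suc k)\<bar>))"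

(* For probability spaces the supremum is over a nonempty set of reals bounded by 1. *)
definition tv_dist ::
    "'a measure \<Rightarrow> ('a \<Rightarrow> real) \<Rightarrow> 'b measure \<Rightarrow> ('b \<Rightarrow> real) \<Rightarrow> real" where
  "tv_dist M\<^sub>1 X\<^sub>1 M\<^sub>2 X\<^sub>2 =
     (SUP A\<in>sets (borel :: real measure).
        \<bar>\<P>(\<omega> in M\<^sub>1. X\<^sub>1 \<omega> \<in> A) - \<P>(\<omega> in M\<^sub>2. X\<^sub>2 \<omega> \<in> A)\<bar>)"

end

(* Binomial inversion writes P(X = j) as the sum over k of (-1)^(k-j) C(k,j) E C(X,k); the
   exponential moment makes this series absolutely convergent, because the sum over k of
   C(k,j) C(n,k) is C(n,j) 2^(n-j), which is O((1+t')^n) as soon as t' > 1. Half the l1-distance of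
   the two laws is therefore at most half the sum over j and k of C(k,j) |E C(X1,k) - E C(X2,k)|,
   and summing over j first produces the factors 2^(k-1). *)
theory Submission
  imports Defs
begin

text \<open>Since C(n,k) C(k,j) = C(n,j) C(n-j,k-j), the common factor C(n,j) comes out and the
  binomial theorem sums the rest. The case \<open>x = -1\<close> gives the inversion,
  \<open>x = 1\<close> its absolute convergence. Truncation in \<open>k - j\<close> is harmless,
  because C(k,j) vanishes for k < j.\<close>

lemma sum_choose_mult_choose_power:
  fixes x :: "'a::comm_ring_1"
  shows "(\<Sum>k\<le>n. of_nat (k choose j) * of_nat (n choose k) * x ^ (k - j)) =
    of_nat (n choose j) * (x + 1) ^ (n - j)"
proof (cases "j \<le> n")
  case True
  have "(\<Sum>k\<le>n. of_nat (k choose j) * of_nat (n choose k) * x ^ (k - j)) =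
      (\<Sum>k\<in>{j..n}. of_nat (k choose j) * of_nat (n choose k) * x ^ (k - j))"
    by (rule sum.mono_neutral_right) (auto simp: not_le binomial_eq_0)
  also have "\<dots> = (\<Sum>k\<in>{j..n}. of_nat (n choose j) * (of_nat (n - j choose (k - j)) * x ^ (k - j)))"
  proof (rule sum.cong)
    fix k assume "k \<in> {j..n}"
    then have "(n choose k) * (k choose j) = (n choose j) * (n - j choose (k - j))"
      by (intro choose_mult) auto
    then have "of_nat (n choose k) * of_nat (k choose j) =
        (of_nat (n choose j) * of_nat (n - j choose (k - j)) :: 'a)"
      by (metis of_nat_mult)
    then show "of_nat (k choose j) * of_nat (n choose k) * x ^ (k - j) =
        of_nat (n choose j) * (of_nat (n - j choose (k - j)) * x ^ (k - j))"
      by (simp add: mult.commute mult.left_commute)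
  qed simp
  also have "\<dots> = (\<Sum>i\<le>n - j. of_nat (n choose j) * (of_nat (n - j choose i) * x ^ i))"
    by (rule sum.reindex_bij_witness[of _ "\<lambda>i. i + j" "\<lambda>k. k - j"]) (use True in auto)
  also have "\<dots> = of_nat (n choose j) * (x + 1) ^ (n - j)"
    by (simp add: binomial_ring sum_distrib_left)
  finally show ?thesis .
next
  case False
  then have "(\<Sum>k\<le>n. of_nat (k choose j) * of_nat (n choose k) * x ^ (k - j)) = 0"
    by (intro sum.neutral) (auto simp: binomial_eq_0)
  with False show ?thesis by (simp add: binomial_eq_0)
qed

text \<open>For j at most n the left side is one term of the binomial expansion of (a + s)^n, whose
  terms are all nonnegative.\<close>

lemma choose_mult_power_le:
  fixes a s :: real
  assumes "a \<ge> 0" "s \<ge> 0"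
  shows "real (n choose j) * a ^ (n - j) * s ^ j \<le> (a + s) ^ n"
proof (cases "j \<le> n")
  case True
  have "real (n choose j) * s ^ j * a ^ (n - j) \<le>
      (\<Sum>k\<le>n. real (n choose k) * s ^ k * a ^ (n - k))"
    by (rule member_le_sum[where f = "\<lambda>k. real (n choose k) * s ^ k * a ^ (n - k)"])
      (use True assms in auto)
  also have "\<dots> = (a + s) ^ n"
    by (simp add: binomial_ring add.commute[of a])
  finally show ?thesis by (simp add: mult_ac)
qed (use assms in \<open>auto simp: binomial_eq_0\<close>)

lemma descending_factorial_of_nat:
  "descending_factorial (real n) k = fact k * real (n choose k)"
  by (simp add: descending_factorial_def binomial_gbinomial gbinomial_prod_rev
      atLeast0LessThan)

text \<open>The triangle inequality for partial sums passes to the limit. Only convergence of the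
  series is assumed: if it is not absolute, the right side is infinite.\<close>

lemma sums_abs_le_ennreal:
  fixes f :: "nat \<Rightarrow> real"
  assumes "f sums s"
  shows "ennreal \<bar>s\<bar> \<le> (\<Sum>i. ennreal \<bar>f i\<bar>)"
proof (rule LIMSEQ_le_const2)
  show "(\<lambda>n. ennreal \<bar>\<Sum>i<n. f i\<bar>) \<longlonglongrightarrow> ennreal \<bar>s\<bar>"
    using assms by (intro tendsto_ennrealI tendsto_rabs) (simp add: sums_def)
  have "ennreal \<bar>\<Sum>i<n. f i\<bar> \<le> (\<Sum>i. ennreal \<bar>f i\<bar>)" for n
  proof -
    have "ennreal \<bar>\<Sum>i<n. f i\<bar> \<le> (\<Sum>i<n. ennreal \<bar>f i\<bar>)"
      by (simp add: sum_ennreal ennreal_leI sum_abs)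
    also have "\<dots> \<le> (\<Sum>i. ennreal \<bar>f i\<bar>)"
      by (intro sum_le_suminf) auto
    finally show ?thesis .
  qed
  then show "\<exists>N. \<forall>n\<ge>N. ennreal \<bar>\<Sum>i<n. f i\<bar> \<le> (\<Sum>i. ennreal \<bar>f i\<bar>)"
    by blast
qed

text \<open>Tonelli for counting measure on the naturals: one series is read as an integral and the
  other pulled out of it by monotone convergence.\<close>

lemma suminf_commute_ennreal:
  fixes f :: "nat \<Rightarrow> nat \<Rightarrow> ennreal"
  shows "(\<Sum>i. \<Sum>j. f i j) = (\<Sum>j. \<Sum>i. f i j)"
proof -
  have "(\<Sum>i. \<Sum>j. f i j) = (\<integral>\<^sup>+i. (\<Sum>j. f i j) \<partial>count_space UNIV)"
    by (simp add: nn_integral_count_space_nat)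
  also have "\<dots> = (\<Sum>j. \<integral>\<^sup>+i. f i j \<partial>count_space UNIV)"
    by (rule nn_integral_suminf) simp
  also have "\<dots> = (\<Sum>j. \<Sum>i. f i j)"
    by (simp add: nn_integral_count_space_nat)
  finally show ?thesis .
qed

lemma suminf_choose_lower:
  assumes "c \<ge> 0"
  shows "(\<Sum>j. ennreal (real (k choose j) * c)) = ennreal (2 ^ k * c)"
proof -
  have "(\<Sum>j. ennreal (real (k choose j) * c)) = (\<Sum>j\<le>k. ennreal (real (k choose j) * c))"
    by (rule suminf_finite) (auto simp: not_le binomial_eq_0)
  also have "\<dots> = ennreal ((\<Sum>j\<le>k. real (k choose j)) * c)"
    using assms by (simp add: sum_ennreal sum_distrib_right)
  also have "(\<Sum>j\<le>k. real (k choose j)) = 2 ^ k"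
    using choose_row_sum[of k] by (metis of_nat_sum of_nat_numeral of_nat_power)
  finally show ?thesis .
qed

lemma (in prob_space) integrable_choose:
  fixes N :: "'a \<Rightarrow> nat"
  assumes [measurable]: "N \<in> measurable M (count_space UNIV)"
    and int: "integrable M (\<lambda>\<omega>. b ^ N \<omega>)" and "b \<ge> (2::real)"
  shows "integrable M (\<lambda>\<omega>. real (N \<omega> choose k))"
proof (rule Bochner_Integration.integrable_bound[OF int])
  have "real (n choose k) \<le> b ^ n" for n
  proof -
    have "real (n choose k) \<le> 2 ^ n"
      using choose_mult_power_le[of 1 1 n k] by simp
    also have "\<dots> \<le> b ^ n"
      using \<open>b \<ge> 2\<close> by (intro power_mono) auto
    finally show ?thesis .
  qed
  then show "AE \<omega> in M. norm (real (N \<omega> choose k)) \<le> norm (b ^ N \<omega>)"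
    using \<open>b \<ge> 2\<close> by auto
qed measurable

text \<open>The inversion is a finite identity at each sample point; what needs proof is exchanging
  the series with the expectation. The strict inequality b > 2 provides an integrable majorant of
  the absolute partial sums.\<close>

lemma (in prob_space) prob_eq_sums_binomial_moments:
  fixes N :: "'a \<Rightarrow> nat"
  assumes N[measurable]: "N \<in> measurable M (count_space UNIV)"
    and int: "integrable M (\<lambda>\<omega>. b ^ N \<omega>)" and b: "b > (2::real)"
  shows "(\<lambda>k. (-1) ^ (k - j) * real (k choose j) * expectation (\<lambda>\<omega>. real (N \<omega> choose k)))
    sums prob {\<omega>\<in>space M. N \<omega> = j}"
proof -
  define f where "f k \<omega> = (-1) ^ (k - j) * real (k choose j) * real (N \<omega> choose k)" for k \<omega>
  note intC = integrable_choose[OF N int less_imp_le[OF b]]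
  have intf: "integrable M (f k)" for k
    unfolding f_def using intC by simp
  \<comment> \<open>The factor \<open>1 ^ (k - j)\<close> is kept so that the right side matches
    \<open>sum_choose_mult_choose_power\<close> at \<open>x = 1\<close>.\<close>
  have nf: "norm (f k \<omega>) = real (k choose j) * real (N \<omega> choose k) * 1 ^ (k - j)" for k \<omega>
    by (simp add: f_def abs_mult power_abs)
  have f0: "f k \<omega> = 0" if "k \<notin> {..N \<omega>}" for k \<omega>
    using that by (simp add: f_def binomial_eq_0)
  have fsums: "(\<lambda>k. f k \<omega>) sums indicator {\<omega>\<in>space M. N \<omega> = j} \<omega>" if "\<omega> \<in> space M" for \<omega>
  proof -
    have "(\<Sum>k\<le>N \<omega>. f k \<omega>) = real (N \<omega> choose j) * (-1 + 1) ^ (N \<omega> - j)"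
      unfolding sum_choose_mult_choose_power[symmetric] f_def by (simp add: mult_ac)
    \<comment> \<open>For \<open>N \<omega> < j\<close> the binomial coefficient is 0, for
      \<open>N \<omega> > j\<close> the power of 0 is, and at equality 0^0 = 1.\<close>
    also have "\<dots> = indicator {\<omega>\<in>space M. N \<omega> = j} \<omega>"
      using that by (auto simp: indicator_def power_0_left)
    finally show ?thesis
      using sums_finite[of "{..N \<omega>}" "\<lambda>k. f k \<omega>"] f0 by simp
  qed
  have partial: "(\<Sum>k<m. norm (f k \<omega>)) \<le> b ^ N \<omega> / (b - 2) ^ j" for m \<omega>
  proof -
    have "(\<Sum>k<m. norm (f k \<omega>)) = (\<Sum>k\<in>{..<m} \<inter> {..N \<omega>}. norm (f k \<omega>))"
      by (rule sum.mono_neutral_right) (use f0 in auto)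
    also have "\<dots> \<le> (\<Sum>k\<le>N \<omega>. norm (f k \<omega>))"
      by (rule sum_mono2) auto
    also have "\<dots> = real (N \<omega> choose j) * (1 + 1) ^ (N \<omega> - j)"
      unfolding nf by (rule sum_choose_mult_choose_power)
    \<comment> \<open>Splitting b as 2 + (b - 2) leaves exactly the factor (b - 2)^j, positive
      because b > 2, to divide by. The resulting bound does not depend on \<open>m\<close>.\<close>
    also have "\<dots> \<le> b ^ N \<omega> / (b - 2) ^ j"
      using choose_mult_power_le[of 2 "b - 2" "N \<omega>" j] b by (simp add: field_simps)
    finally show ?thesis .
  qed
  have "AE \<omega> in M. summable (\<lambda>k. norm (f k \<omega>))"
    using partial by (intro AE_I2 summableI_nonneg_bounded) auto
  moreover have "summable (\<lambda>k. \<integral>\<omega>. norm (f k \<omega>) \<partial>M)"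
  proof (rule summableI_nonneg_bounded)
    fix m
    have "(\<Sum>k<m. \<integral>\<omega>. norm (f k \<omega>) \<partial>M) = (\<integral>\<omega>. (\<Sum>k<m. norm (f k \<omega>)) \<partial>M)"
      using intf by (intro Bochner_Integration.integral_sum[symmetric]) simp
    also have "\<dots> \<le> (\<integral>\<omega>. b ^ N \<omega> / (b - 2) ^ j \<partial>M)"
      using partial intf int by (intro integral_mono) auto
    finally show "(\<Sum>k<m. \<integral>\<omega>. norm (f k \<omega>) \<partial>M) \<le> (\<integral>\<omega>. b ^ N \<omega> / (b - 2) ^ j \<partial>M)" .
  qed simp
  ultimately have "(\<lambda>k. expectation (f k)) sums (\<integral>\<omega>. (\<Sum>k. f k \<omega>) \<partial>M)"
    by (intro sums_integral intf)
  also have "(\<integral>\<omega>. (\<Sum>k. f k \<omega>) \<partial>M) = (\<integral>\<omega>. indicator {\<omega>\<in>space M. N \<omega> = j} \<omega> \<partial>M)"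
    using fsums by (intro Bochner_Integration.integral_cong) (auto simp: sums_iff)
  also have "\<dots> = prob {\<omega>\<in>space M. N \<omega> = j}"
    by simp
  finally show ?thesis
    by (simp add: f_def)
qed

lemma (in prob_space) prob_mem_sums:
  fixes N :: "'a \<Rightarrow> nat"
  assumes [measurable]: "N \<in> measurable M (count_space UNIV)"
  shows "(\<lambda>j. indicator B j * prob {\<omega>\<in>space M. N \<omega> = j}) sums prob {\<omega>\<in>space M. N \<omega> \<in> B}"
proof -
  have "(\<lambda>j. prob {\<omega>\<in>space M. N \<omega> = j \<and> j \<in> B}) sums
      prob (\<Union>j. {\<omega>\<in>space M. N \<omega> = j \<and> j \<in> B})"
    by (rule finite_measure_UNION) (auto simp: disjoint_family_on_def)
  also have "(\<Union>j. {\<omega>\<in>space M. N \<omega> = j \<and> j \<in> B}) = {\<omega>\<in>space M. N \<omega> \<in> B}"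
    by auto
  also have "(\<lambda>j. prob {\<omega>\<in>space M. N \<omega> = j \<and> j \<in> B}) =
      (\<lambda>j. indicator B j * prob {\<omega>\<in>space M. N \<omega> = j})"
    by (auto simp: indicator_def fun_eq_iff)
  finally show ?thesis .
qed

text \<open>Reduces arbitrary events to point masses. The factor 1/2 is essential: row sums of
  binomial coefficients give 2^k, whereas the distance offers only \<alpha>^(k-1).\<close>

lemma prob_diff_le_half_l1:
  fixes N\<^sub>1 :: "'a \<Rightarrow> nat" and N\<^sub>2 :: "'b \<Rightarrow> nat"
  assumes "prob_space M\<^sub>1" "prob_space M\<^sub>2"
    and [measurable]: "N\<^sub>1 \<in> measurable M\<^sub>1 (count_space UNIV)"
      "N\<^sub>2 \<in> measurable M\<^sub>2 (count_space UNIV)"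
  shows "ennreal \<bar>\<P>(\<omega> in M\<^sub>1. N\<^sub>1 \<omega> \<in> B) - \<P>(\<omega> in M\<^sub>2. N\<^sub>2 \<omega> \<in> B)\<bar> \<le>
    (\<Sum>j. ennreal (\<bar>\<P>(\<omega> in M\<^sub>1. N\<^sub>1 \<omega> = j) - \<P>(\<omega> in M\<^sub>2. N\<^sub>2 \<omega> = j)\<bar> / 2))"
proof -
  interpret P1: prob_space M\<^sub>1 by fact
  interpret P2: prob_space M\<^sub>2 by fact
  define d where "d j = \<P>(\<omega> in M\<^sub>1. N\<^sub>1 \<omega> = j) - \<P>(\<omega> in M\<^sub>2. N\<^sub>2 \<omega> = j)" for j
  have dB: "(\<lambda>j. indicator C j * d j) sums
      (\<P>(\<omega> in M\<^sub>1. N\<^sub>1 \<omega> \<in> C) - \<P>(\<omega> in M\<^sub>2. N\<^sub>2 \<omega> \<in> C))" for C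
    using sums_diff[OF P1.prob_mem_sums P2.prob_mem_sums, of N\<^sub>1 N\<^sub>2 C C]
    by (simp add: d_def algebra_simps)
  \<comment> \<open>Both laws have total mass 1.\<close>
  have "d sums 0"
    using dB[of UNIV] by (simp add: P1.prob_space P2.prob_space)
  \<comment> \<open>Recentring the indicator at 1/2 costs nothing since d has total mass 0, and gains the factor 1/2.\<close>
  from sums_diff[OF dB[of B] sums_mult[OF this, of "1/2"]]
  have centred: "(\<lambda>j. (indicator B j - 1/2) * d j) sums
      (\<P>(\<omega> in M\<^sub>1. N\<^sub>1 \<omega> \<in> B) - \<P>(\<omega> in M\<^sub>2. N\<^sub>2 \<omega> \<in> B))"
    by (simp add: algebra_simps)
  have half: "\<bar>(indicator B j - 1/2) * d j\<bar> = \<bar>d j\<bar> / 2" for j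
    by (cases "j \<in> B") simp_all
  show ?thesis
    using sums_abs_le_ennreal[OF centred] unfolding half unfolding d_def .
qed

text \<open>With t' > 1 from the class, b = 1 + t' exceeds 2. Replacing X by a variable that is
  natural-valued everywhere lets the binomial identities be used pointwise, with no exceptional null
  set.\<close>

lemma (in prob_space) rv_class_1_natE:
  assumes "X \<in> rv_class M 1"
  obtains N :: "'a \<Rightarrow> nat" and b :: real
  where "N \<in> measurable M (count_space UNIV)" "AE \<omega> in M. X \<omega> = real (N \<omega>)"
    "b > 2" "integrable M (\<lambda>\<omega>. b ^ N \<omega>)"
proof -
  from assms obtain t where [measurable]: "X \<in> borel_measurable M"
    and nat: "AE \<omega> in M. X \<omega> \<in> \<nat>" and t: "t > 1"
    and fin: "(\<integral>\<^sup>+\<omega>. ennreal ((1 + t) powr X \<omega>) \<partial>M) < \<infinity>"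
    by (auto simp: rv_class_def)
  define N where "N \<omega> = nat \<lfloor>X \<omega>\<rfloor>" for \<omega>
  have N[measurable]: "N \<in> measurable M (count_space UNIV)"
    unfolding N_def by measurable
  have XN: "AE \<omega> in M. X \<omega> = real (N \<omega>)"
    using nat by eventually_elim (auto simp: N_def elim: Nats_cases)
  have "(\<integral>\<^sup>+\<omega>. ennreal ((1 + t) ^ N \<omega>) \<partial>M) = (\<integral>\<^sup>+\<omega>. ennreal ((1 + t) powr X \<omega>) \<partial>M)"
    by (rule nn_integral_cong_AE) (use XN t in \<open>auto simp: powr_realpow\<close>)
  with fin t have "integrable M (\<lambda>\<omega>. (1 + t) ^ N \<omega>)"
    by (intro integrableI_nonneg) auto
  with N XN t that[of N "1 + t"] show ?thesis by auto
qed

text \<open>On naturals (n)_k = k! C(n,k), so the k! in the denominator of the distance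
  cancels.\<close>

lemma factorial_moment_eq_binomial_moment:
  assumes "AE \<omega> in M. X \<omega> = real (N \<omega>)" "X \<in> borel_measurable M"
    and [measurable]: "N \<in> measurable M (count_space UNIV)"
  shows "factorial_moment M X k = fact k * (\<integral>\<omega>. real (N \<omega> choose k) \<partial>M)"
proof -
  have [measurable]: "(\<lambda>\<omega>. descending_factorial (X \<omega>) k) \<in> borel_measurable M"
    using assms(2) unfolding descending_factorial_def by measurable
  have "factorial_moment M X k = (\<integral>\<omega>. fact k * real (N \<omega> choose k) \<partial>M)"
    unfolding factorial_moment_def
    by (rule integral_cong_AE) (use assms(1) in \<open>auto simp: descending_factorial_of_nat\<close>)
  then show ?thesis by simp
qed

theorem theorem2p1:
  fixes M\<^sub>1 :: "'a measure" and M\<^sub>2 :: "'b measure"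
    and X\<^sub>1 :: "'a \<Rightarrow> real" and X\<^sub>2 :: "'b \<Rightarrow> real" and \<alpha> :: real
  assumes "prob_space M\<^sub>1" and "prob_space M\<^sub>2"
    and "X\<^sub>1 \<in> rv_class M\<^sub>1 1" and "X\<^sub>2 \<in> rv_class M\<^sub>2 1"
    and "\<alpha> \<ge> 2"
  shows "ennreal (tv_dist M\<^sub>1 X\<^sub>1 M\<^sub>2 X\<^sub>2) \<le> factorial_moment_dist \<alpha> M\<^sub>1 X\<^sub>1 M\<^sub>2 X\<^sub>2"
proof -
  interpret P1: prob_space M\<^sub>1 by fact
  interpret P2: prob_space M\<^sub>2 by fact
  obtain N\<^sub>1 b\<^sub>1 where N1[measurable]: "N\<^sub>1 \<in> measurable M\<^sub>1 (count_space UNIV)"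
    and X1: "AE \<omega> in M\<^sub>1. X\<^sub>1 \<omega> = real (N\<^sub>1 \<omega>)"
    and b1: "b\<^sub>1 > (2::real)" "integrable M\<^sub>1 (\<lambda>\<omega>. b\<^sub>1 ^ N\<^sub>1 \<omega>)"
    by (rule P1.rv_class_1_natE[OF assms(3)])
  obtain N\<^sub>2 b\<^sub>2 where N2[measurable]: "N\<^sub>2 \<in> measurable M\<^sub>2 (count_space UNIV)"
    and X2: "AE \<omega> in M\<^sub>2. X\<^sub>2 \<omega> = real (N\<^sub>2 \<omega>)"
    and b2: "b\<^sub>2 > (2::real)" "integrable M\<^sub>2 (\<lambda>\<omega>. b\<^sub>2 ^ N\<^sub>2 \<omega>)"
    by (rule P2.rv_class_1_natE[OF assms(4)])
  have [measurable]: "X\<^sub>1 \<in> borel_measurable M\<^sub>1" "X\<^sub>2 \<in> borel_measurable M\<^sub>2"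
    using assms(3,4) by (auto simp: rv_class_def)
  define e where
    "e k = P1.expectation (\<lambda>\<omega>. real (N\<^sub>1 \<omega> choose k)) - P2.expectation (\<lambda>\<omega>. real (N\<^sub>2 \<omega> choose k))" for k
  define d where "d j = \<P>(\<omega> in M\<^sub>1. N\<^sub>1 \<omega> = j) - \<P>(\<omega> in M\<^sub>2. N\<^sub>2 \<omega> = j)" for j
  \<comment> \<open>Both zeroth moments equal 1; this is why the series of the distance can start at
    order 1.\<close>
  have "e 0 = 0"
    by (simp add: e_def P1.prob_space P2.prob_space)
  have inversion: "(\<lambda>k. (-1) ^ (k - j) * real (k choose j) * e k) sums d j" for j
    using sums_diff[OF P1.prob_eq_sums_binomial_moments[OF N1 b1(2,1)]
        P2.prob_eq_sums_binomial_moments[OF N2 b2(2,1)], of j j]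
    by (simp add: e_def d_def algebra_simps)
  have "ennreal (\<bar>d j\<bar> / 2) \<le> (\<Sum>k. ennreal (real (k choose j) * (\<bar>e k\<bar> / 2)))" for j
    using sums_abs_le_ennreal[OF sums_mult[OF inversion, of "1/2" j]]
    by (simp add: abs_mult power_abs)
  then have "(\<Sum>j. ennreal (\<bar>d j\<bar> / 2)) \<le> (\<Sum>j. \<Sum>k. ennreal (real (k choose j) * (\<bar>e k\<bar> / 2)))"
    by (intro suminf_le) auto
  \<comment> \<open>In [0, \<infinity>] the exchange requires no summability; for fixed k the sum
    over j is then a full binomial row.\<close>
  also have "\<dots> = (\<Sum>k. ennreal (2 ^ k * (\<bar>e k\<bar> / 2)))"
    by (rule trans[OF suminf_commute_ennreal]) (intro suminf_cong suminf_choose_lower, simp)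
  \<comment> \<open>The vanishing term at 0 is dropped to match the shifted index of
    \<open>factorial_moment_dist\<close>; halving 2^(k+1) gives 2^k, to be compared with
    \<alpha>^k.\<close>
  also have "\<dots> = (\<Sum>k. ennreal (2 ^ Suc k * (\<bar>e (Suc k)\<bar> / 2)))"
    by (subst suminf_offset[of _ 1]) (simp_all add: \<open>e 0 = 0\<close>)
  also have "\<dots> \<le> factorial_moment_dist \<alpha> M\<^sub>1 X\<^sub>1 M\<^sub>2 X\<^sub>2"
    unfolding factorial_moment_dist_def
  proof (intro suminf_le ennreal_leI summableI)
    fix k
    have "factorial_moment M\<^sub>1 X\<^sub>1 (Suc k) - factorial_moment M\<^sub>2 X\<^sub>2 (Suc k) = fact (Suc k) * e (Suc k)"
      using X1 X2 by (simp add: factorial_moment_eq_binomial_moment[where N = N\<^sub>1]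
          factorial_moment_eq_binomial_moment[where N = N\<^sub>2] e_def right_diff_distrib del: fact_Suc)
    moreover have "2 ^ k * \<bar>e (Suc k)\<bar> \<le> \<alpha> ^ k * \<bar>e (Suc k)\<bar>"
      using \<open>\<alpha> \<ge> 2\<close> by (intro mult_right_mono power_mono) auto
    ultimately show "2 ^ Suc k * (\<bar>e (Suc k)\<bar> / 2) \<le> \<alpha> ^ k / fact (Suc k) *
        \<bar>factorial_moment M\<^sub>1 X\<^sub>1 (Suc k) - factorial_moment M\<^sub>2 X\<^sub>2 (Suc k)\<bar>"
      by (simp add: abs_mult del: fact_Suc)
  qed
  finally have l1: "(\<Sum>j. ennreal (\<bar>d j\<bar> / 2)) \<le> factorial_moment_dist \<alpha> M\<^sub>1 X\<^sub>1 M\<^sub>2 X\<^sub>2" .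
  have bound: "ennreal \<bar>\<P>(\<omega> in M\<^sub>1. X\<^sub>1 \<omega> \<in> A) - \<P>(\<omega> in M\<^sub>2. X\<^sub>2 \<omega> \<in> A)\<bar> \<le>
      factorial_moment_dist \<alpha> M\<^sub>1 X\<^sub>1 M\<^sub>2 X\<^sub>2" if [measurable]: "A \<in> sets borel" for A
  proof -
    \<comment> \<open>Both laws live on the naturals up to null sets, so a Borel set matters only
      through the naturals it contains.\<close>
    define B where "B = {n. real n \<in> A}"
    have "\<P>(\<omega> in M\<^sub>1. X\<^sub>1 \<omega> \<in> A) = \<P>(\<omega> in M\<^sub>1. N\<^sub>1 \<omega> \<in> B)"
      by (rule P1.prob_eq_AE) (use X1 in \<open>auto simp: B_def\<close>)
    moreover have "\<P>(\<omega> in M\<^sub>2. X\<^sub>2 \<omega> \<in> A) = \<P>(\<omega> in M\<^sub>2. N\<^sub>2 \<omega> \<in> B)"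
      by (rule P2.prob_eq_AE) (use X2 in \<open>auto simp: B_def\<close>)
    ultimately show ?thesis
      using order_trans[OF prob_diff_le_half_l1[OF assms(1,2) N1 N2, of B] l1[unfolded d_def]]
      by simp
  qed
  \<comment> \<open>\<open>tv_dist\<close> is a supremum of reals, so the bound is taken to the
    reals when the distance is finite; an infinite distance leaves nothing to prove.\<close>
  show ?thesis
  proof (cases "factorial_moment_dist \<alpha> M\<^sub>1 X\<^sub>1 M\<^sub>2 X\<^sub>2")
    case (real r)
    then have "tv_dist M\<^sub>1 X\<^sub>1 M\<^sub>2 X\<^sub>2 \<le> r"
      unfolding tv_dist_def using bound by (intro cSUP_least) (auto simp: ennreal_le_iff)
    with real show ?thesis by (simp add: ennreal_leI)
  qed simp
qed

end
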